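(* Let $\alpha$ be an ordinal, let $\mathfrak{A}=\langle A,*_\kappa,v_\kappa\rangle_{\kappa<\alpha}$ be a substitution algebra of dimension $\alpha$, and let $\Gamma$ be a finite subset of $\alpha$. Define $\phi_\Gamma:A\to F_\alpha(Z(\Gamma))$ by $\phi_\Gamma(a)(s)=s*_{(\Gamma)}a$ for $a\in A$ and $s\in Z(\Gamma)^\alpha$. Then $\phi_\Gamma$ is a $\Gamma$-homomorphism from $\mathfrak{A}$ into the full function substitution algebra of dimension $\alpha$ with base $Z(\Gamma)$.
   Context: For a nonempty set $U$, $F_\alpha(U)$ is the set of all functions from $U^\alpha$ to $U$. For $s\in U^\alpha$, $\kappa<\alpha$, $x\in U$, $s\langle\kappa,x\rangle\in U^\alpha$ agrees with $s$ except that its $\kappa$-th entry is $x$. On $F_\alpha(U)$ define $(f*_\kappa g)(s)=g(s\langle\kappa,f(s)\rangle)$ and $V_\kappa(s)=s_\kappa$. The full function substitution algebra of dimension $\alpha$ with base $U$ is $\langle F_\alpha(U),*_\kappa,V_\kappa\rangle_{\kappa<\alpha}$. A substitution algebra of dimension $\alpha$ ($SA_\alpha$) is an algebra $\langle A,*_\kappa,v_\kappa\rangle_{\kappa<\alpha}$ ($*_\kappa$ binary operations, $v_\kappa$ constants) satisfying, for all $\kappa,\lambda<\alpha$: (1) $x*_\kappa v_\kappa=x$; (2) $x*_\kappa v_\lambda=v_\lambda$ for $\kappa\neq\lambda$; (3) $v_\kappa*_\kappa x=x$; (4) if $w*_\lambda x=x$ for all $w$, then $x*_\lambda(v_\lambda*_\kappa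 z)=x*_\lambda(x*_\kappa z)$; (5) $(x*_\kappa y)*_\kappa z=x*_\kappa(y*_\kappa z)$; (6) if $w*_\lambda x=x$ for all $w$, then $x*_\kappa(y*_\lambda z)=(x*_\kappa y)*_\lambda(x*_\kappa z)$ for $\kappa\neq\lambda$. For $x\in A$, $\Delta x=\{\kappa<\alpha: a*_\kappa x\neq x \text{ for some } a\in A\}$. For $\Gamma\subseteq\alpha$, $Z(\Gamma)=\{x\in A:\Delta x\cap\Gamma=\emptyset\}$. For $s\in A^\alpha$, $a\in A$ and finite $\Gamma=\{\kappa_0<\dots<\kappa_{n-1}\}\subseteq\alpha$, the generalized substitution is $s*_{(\Gamma)}a=s_{\kappa_{n-1}}*_{\kappa_{n-1}}(\cdots(s_{\kappa_1}*_{\kappa_1}(s_{\kappa_0}*_{\kappa_0}a))\cdots)$ (and $s*_{(\emptyset)}a=a$). For $SA_\alpha$'s $\mathfrak{A}=\langle A,*_\kappa,v_\kappa\rangle$, $\mathfrak{A}'=\langle A',*'_\kappa,v'_\kappa\rangle$ and $\Gamma\subseteq\alpha$, a map $\phi:A\to A'$ is a $\Gamma$-homomorphism if $\phi(a*_\kappa b)=\phi(a)*'_\kappa\phi(b)$ and $\phi(v_\kappa)=v'_\kappa$ for all $\kappa\in\Gamma$ and $a,b\in A$. *)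

theory Defs
  imports Main "HOL-Library.FuncSet"
begin

text \<open>
  An ordinal \<open>\<alpha>\<close> is an element of an arbitrary type of class \<open>wellorder\<close>, identified as usual
  with the set \<open>{..<\<alpha>}\<close> of its predecessors. Every ordinal, including 0, arises in this way
  (as the top element of a well-order of type \<open>\<alpha> + 1\<close>).
\<close>

record ('o, 'a) subst_struct =
  carrier :: "'a set"
  sub :: "'o \<Rightarrow> 'a \<Rightarrow> 'a \<Rightarrow> 'a"
  var :: "'o \<Rightarrow> 'a"

text \<open>
  \<open>sub A \<kappa> x y\<close> is \<open>x *\<^sub>\<kappa> y\<close>. Only the values for indices below \<open>\<alpha>\<close> and for arguments in the
  carrier matter.
\<close>

locale substitution_algebra =
  fixes \<alpha> :: "'o::wellorder" and A :: "('o, 'a) subst_struct"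
  assumes sub_closed:
      "\<lbrakk>\<kappa> < \<alpha>; x \<in> carrier A; y \<in> carrier A\<rbrakk> \<Longrightarrow> sub A \<kappa> x y \<in> carrier A"
    and var_closed: "\<kappa> < \<alpha> \<Longrightarrow> var A \<kappa> \<in> carrier A"
    and sub_var: "\<lbrakk>\<kappa> < \<alpha>; x \<in> carrier A\<rbrakk> \<Longrightarrow> sub A \<kappa> x (var A \<kappa>) = x"
    and sub_other_var:
      "\<lbrakk>\<kappa> < \<alpha>; \<mu> < \<alpha>; \<kappa> \<noteq> \<mu>; x \<in> carrier A\<rbrakk> \<Longrightarrow> sub A \<kappa> x (var A \<mu>) = var A \<mu>"
    and var_sub: "\<lbrakk>\<kappa> < \<alpha>; x \<in> carrier A\<rbrakk> \<Longrightarrow> sub A \<kappa> (var A \<kappa>) x = x"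
    and sub_var_sub:
      "\<lbrakk>\<kappa> < \<alpha>; \<mu> < \<alpha>; x \<in> carrier A; z \<in> carrier A;
        \<forall>w \<in> carrier A. sub A \<mu> w x = x\<rbrakk>
       \<Longrightarrow> sub A \<mu> x (sub A \<kappa> (var A \<mu>) z) = sub A \<mu> x (sub A \<kappa> x z)"
    and sub_assoc:
      "\<lbrakk>\<kappa> < \<alpha>; x \<in> carrier A; y \<in> carrier A; z \<in> carrier A\<rbrakk>
       \<Longrightarrow> sub A \<kappa> (sub A \<kappa> x y) z = sub A \<kappa> x (sub A \<kappa> y z)"
    and sub_distrib:
      "\<lbrakk>\<kappa> < \<alpha>; \<mu> < \<alpha>; \<kappa> \<noteq> \<mu>; x \<in> carrier A; y \<in> carrier A; z \<in> carrier A;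
        \<forall>w \<in> carrier A. sub A \<mu> w x = x\<rbrakk>
       \<Longrightarrow> sub A \<kappa> x (sub A \<mu> y z) = sub A \<mu> (sub A \<kappa> x y) (sub A \<kappa> x z)"

definition dim_set :: "'o::wellorder \<Rightarrow> ('o, 'a) subst_struct \<Rightarrow> 'a \<Rightarrow> 'o set" where
  "dim_set \<alpha> A x = {\<kappa>. \<kappa> < \<alpha> \<and> (\<exists>a \<in> carrier A. sub A \<kappa> a x \<noteq> x)}"

definition zero_dim :: "'o::wellorder \<Rightarrow> ('o, 'a) subst_struct \<Rightarrow> 'o set \<Rightarrow> 'a set" where
  "zero_dim \<alpha> A \<Gamma> = {x \<in> carrier A. dim_set \<alpha> A x \<inter> \<Gamma> = {}}"

text \<open>\<open>seqs \<alpha> U\<close> is \<open>U\<^sup>\<alpha>\<close>, and \<open>s\<langle>\<kappa>, x\<rangle>\<close> is the function update \<open>s(\<kappa> := x)\<close>.\<close>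

definition seqs :: "'o::wellorder \<Rightarrow> 'u set \<Rightarrow> ('o \<Rightarrow> 'u) set" where
  "seqs \<alpha> U = {..<\<alpha>} \<rightarrow>\<^sub>E U"

text \<open>
  The definition makes sense for every \<open>U\<close>; nonemptiness of the base is deliberately not
  built in, since \<open>zero_dim \<alpha> A \<Gamma>\<close> can be empty.
\<close>

definition full_function_algebra ::
    "'o::wellorder \<Rightarrow> 'u set \<Rightarrow> ('o, ('o \<Rightarrow> 'u) \<Rightarrow> 'u) subst_struct" where
  "full_function_algebra \<alpha> U =
     \<lparr>carrier = seqs \<alpha> U \<rightarrow>\<^sub>E U,
      sub = (\<lambda>\<kappa> f g. \<lambda>s \<in> seqs \<alpha> U. g (s(\<kappa> := f s))),
      var = (\<lambda>\<kappa>. \<lambda>s \<in> seqs \<alpha> U. s \<kappa>)\<rparr>"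

text \<open>
  \<open>fold\<close> processes the increasing enumeration of \<open>\<Gamma>\<close> from the left, so the substitution for the
  least element of \<open>\<Gamma>\<close> is the innermost one.
\<close>

definition gen_sub ::
    "('o::wellorder, 'a) subst_struct \<Rightarrow> 'o set \<Rightarrow> ('o \<Rightarrow> 'a) \<Rightarrow> 'a \<Rightarrow> 'a" where
  "gen_sub A \<Gamma> s a = fold (\<lambda>\<kappa> y. sub A \<kappa> (s \<kappa>) y) (sorted_list_of_set \<Gamma>) a"

definition partial_hom ::
    "'o::wellorder \<Rightarrow> 'o set \<Rightarrow> ('o, 'a) subst_struct \<Rightarrow> ('o, 'b) subst_struct
      \<Rightarrow> ('a \<Rightarrow> 'b) \<Rightarrow> bool" where
  "partial_hom \<alpha> \<Gamma> A B \<phi> \<longleftrightarrow>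
     substitution_algebra \<alpha> A \<and> substitution_algebra \<alpha> B \<and> \<Gamma> \<subseteq> {..<\<alpha>} \<and>
     \<phi> \<in> carrier A \<rightarrow> carrier B \<and>
     (\<forall>\<kappa> \<in> \<Gamma>. \<forall>a \<in> carrier A. \<forall>b \<in> carrier A. \<phi> (sub A \<kappa> a b) = sub B \<kappa> (\<phi> a) (\<phi> b)) \<and>
     (\<forall>\<kappa> \<in> \<Gamma>. \<phi> (var A \<kappa>) = var B \<kappa>)"

definition phi_map ::
    "'o::wellorder \<Rightarrow> ('o, 'a) subst_struct \<Rightarrow> 'o set \<Rightarrow> 'a \<Rightarrow> ('o \<Rightarrow> 'a) \<Rightarrow> 'a" where
  "phi_map \<alpha> A \<Gamma> a = (\<lambda>s \<in> seqs \<alpha> (zero_dim \<alpha> A \<Gamma>). gen_sub A \<Gamma> s a)"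

end

theory Submission
  imports Defs
begin

text \<open>
  Elements of \<open>Z(\<Gamma>)\<close> behave like constants for the substitutions indexed by \<open>\<Gamma>\<close>: by axiom (6) the
  operations \<open>x *\<^sub>\<kappa> _\<close> and \<open>y *\<^sub>\<mu> _\<close> commute for \<open>x, y \<in> Z(\<Gamma>)\<close> and distinct \<open>\<kappa>, \<mu> \<in> \<Gamma>\<close>. Hence any
  \<open>\<kappa> \<in> \<Gamma>\<close> can be moved to the innermost or the outermost position of \<open>s *\<^sub>(\<^sub>\<Gamma>\<^sub>) a\<close>. With
  \<open>\<Gamma>' = \<Gamma> - {\<kappa>}\<close>, axioms (5) and (6) give
  \<open>s *\<^sub>(\<^sub>\<Gamma>\<^sub>) (a *\<^sub>\<kappa> b) = s *\<^sub>(\<^sub>\<Gamma>\<^sub>'\<^sub>) ((s\<^sub>\<kappa> *\<^sub>\<kappa> a) *\<^sub>\<kappa> b) = (s *\<^sub>(\<^sub>\<Gamma>\<^sub>) a) *\<^sub>\<kappa> (s *\<^sub>(\<^sub>\<Gamma>\<^sub>'\<^sub>) b)\<close>, where \<open>\<kappa>\<close> is innermost on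
  the left and outermost on the right.
\<close>

section \<open>Full function algebras satisfy the axioms\<close>

lemma seqs_update: "\<lbrakk>s \<in> seqs \<alpha> U; \<kappa> < \<alpha>; u \<in> U\<rbrakk> \<Longrightarrow> s(\<kappa> := u) \<in> seqs \<alpha> U"
  by (auto simp: seqs_def PiE_iff extensional_def)

lemma seqs_mem: "\<lbrakk>s \<in> seqs \<alpha> U; \<kappa> < \<alpha>\<rbrakk> \<Longrightarrow> s \<kappa> \<in> U"
  by (auto simp: seqs_def)

lemma sub_full_function_algebra:
  "s \<in> seqs \<alpha> U \<Longrightarrow> sub (full_function_algebra \<alpha> U) \<kappa> f g s = g (s(\<kappa> := f s))"
  by (simp add: full_function_algebra_def)

lemma var_full_function_algebra:
  "s \<in> seqs \<alpha> U \<Longrightarrow> var (full_function_algebra \<alpha> U) \<kappa> s = s \<kappa>"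
  by (simp add: full_function_algebra_def)

lemma carrier_full_function_algebra:
  "carrier (full_function_algebra \<alpha> U) = seqs \<alpha> U \<rightarrow>\<^sub>E U"
  by (simp add: full_function_algebra_def)

text \<open>Taking for \<open>w\<close> the constant function with value \<open>u\<close> turns the
  side condition of axioms (4) and (6) into insensitivity to one coordinate. Below, an element is
  called independent of an index if every substitution at that index fixes it.\<close>

lemma full_function_algebra_independent:
  assumes x: "\<forall>w \<in> carrier (full_function_algebra \<alpha> U). sub (full_function_algebra \<alpha> U) \<kappa> w x = x"
    and s: "s \<in> seqs \<alpha> U" and u: "u \<in> U"
  shows "x (s(\<kappa> := u)) = x s"
proof -
  let ?c = "\<lambda>t \<in> seqs \<alpha> U. u"
  have "?c \<in> carrier (full_function_algebra \<alpha> U)"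
    using u by (simp add: carrier_full_function_algebra)
  with x have "sub (full_function_algebra \<alpha> U) \<kappa> ?c x s = x s" by simp
  then show ?thesis using s by (simp add: sub_full_function_algebra)
qed

text \<open>Each axiom reduces, by extensionality on \<open>seqs \<alpha> U\<close>, to a pointwise
  identity between updated sequences.\<close>

lemma substitution_algebra_full_function_algebra:
  "substitution_algebra \<alpha> (full_function_algebra \<alpha> U)" (is "substitution_algebra \<alpha> ?F")
proof
  have sub_closed: "sub ?F \<kappa> x y \<in> carrier ?F"
    if "\<kappa> < \<alpha>" "x \<in> carrier ?F" "y \<in> carrier ?F" for \<kappa> x y
    using that by (auto simp: full_function_algebra_def PiE_iff intro!: seqs_update)
  have var_closed: "var ?F \<kappa> \<in> carrier ?F" if "\<kappa> < \<alpha>" for \<kappa>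
    using that by (auto simp: full_function_algebra_def seqs_mem)
  have mem: "x s \<in> U" if "x \<in> carrier ?F" "s \<in> seqs \<alpha> U" for x s
    using that by (auto simp: carrier_full_function_algebra)
  have eqI: "x = y"
    if "x \<in> carrier ?F" "y \<in> carrier ?F" "\<And>s. s \<in> seqs \<alpha> U \<Longrightarrow> x s = y s" for x y
    using that unfolding carrier_full_function_algebra by (rule PiE_ext)
  note closed = sub_closed var_closed
  note eval = sub_full_function_algebra var_full_function_algebra seqs_update mem
  fix \<kappa> \<mu> x y z
  show "\<kappa> < \<alpha> \<Longrightarrow> x \<in> carrier ?F \<Longrightarrow> y \<in> carrier ?F \<Longrightarrow> sub ?F \<kappa> x y \<in> carrier ?F"
    by (rule sub_closed)
  show "\<kappa> < \<alpha> \<Longrightarrow> var ?F \<kappa> \<in> carrier ?F"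
    by (rule var_closed)
  show "sub ?F \<kappa> x (var ?F \<kappa>) = x" if "\<kappa> < \<alpha>" "x \<in> carrier ?F"
    by (rule eqI) (simp_all add: that closed eval)
  show "sub ?F \<kappa> x (var ?F \<mu>) = var ?F \<mu>"
    if "\<kappa> < \<alpha>" "\<mu> < \<alpha>" "\<kappa> \<noteq> \<mu>" "x \<in> carrier ?F"
    by (rule eqI) (use that in \<open>simp_all add: closed eval\<close>)
  show "sub ?F \<kappa> (var ?F \<kappa>) x = x" if "\<kappa> < \<alpha>" "x \<in> carrier ?F"
    by (rule eqI) (simp_all add: that closed eval)
  show "sub ?F \<mu> x (sub ?F \<kappa> (var ?F \<mu>) z) = sub ?F \<mu> x (sub ?F \<kappa> x z)"
    if "\<kappa> < \<alpha>" "\<mu> < \<alpha>" "x \<in> carrier ?F" "z \<in> carrier ?F"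
      "\<forall>w \<in> carrier ?F. sub ?F \<mu> w x = x"
    by (rule eqI)
      (simp_all add: that(1-4) closed eval full_function_algebra_independent[OF that(5)])
  show "sub ?F \<kappa> (sub ?F \<kappa> x y) z = sub ?F \<kappa> x (sub ?F \<kappa> y z)"
    if "\<kappa> < \<alpha>" "x \<in> carrier ?F" "y \<in> carrier ?F" "z \<in> carrier ?F"
    by (rule eqI) (simp_all add: that closed eval)
  show "sub ?F \<kappa> x (sub ?F \<mu> y z) = sub ?F \<mu> (sub ?F \<kappa> x y) (sub ?F \<kappa> x z)"
    if "\<kappa> < \<alpha>" "\<mu> < \<alpha>" "\<kappa> \<noteq> \<mu>" "x \<in> carrier ?F" "y \<in> carrier ?F" "z \<in> carrier ?F"
      "\<forall>w \<in> carrier ?F. sub ?F \<mu> w x = x"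
    by (rule eqI)
      (simp_all add: that(1-6) closed eval full_function_algebra_independent[OF that(7)]
        fun_upd_twist[OF that(3)])
qed

text \<open>Arbitrary lists replace the sorted enumeration in \<open>gen_sub\<close>, so that
  inductions go through and a single index can be split off.\<close>

definition list_sub ::
    "('o::wellorder, 'a) subst_struct \<Rightarrow> ('o \<Rightarrow> 'a) \<Rightarrow> 'o list \<Rightarrow> 'a \<Rightarrow> 'a" where
  "list_sub A s xs a = fold (\<lambda>\<kappa> y. sub A \<kappa> (s \<kappa>) y) xs a"

lemma list_sub_simps [simp]:
  "list_sub A s [] a = a"
  "list_sub A s (\<kappa> # xs) a = list_sub A s xs (sub A \<kappa> (s \<kappa>) a)"
  "list_sub A s (xs @ ys) a = list_sub A s ys (list_sub A s xs a)"
  by (simp_all add: list_sub_def)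

lemma list_sub_cong: "(\<And>\<kappa>. \<kappa> \<in> set xs \<Longrightarrow> s \<kappa> = t \<kappa>) \<Longrightarrow> list_sub A s xs a = list_sub A t xs a"
  unfolding list_sub_def by (rule fold_cong) auto

section \<open>Independence of an index under a single substitution\<close>

context substitution_algebra
begin

lemma zero_dim_iff:
  assumes "\<Gamma> \<subseteq> {..<\<alpha>}"
  shows "x \<in> zero_dim \<alpha> A \<Gamma> \<longleftrightarrow>
    x \<in> carrier A \<and> (\<forall>\<kappa> \<in> \<Gamma>. \<forall>w \<in> carrier A. sub A \<kappa> w x = x)"
  using assms by (auto simp: zero_dim_def dim_set_def)

text \<open>One independent witness \<open>x\<close> fixing \<open>y\<close> suffices: by axiom (5),
  \<open>w *\<^sub>\<mu> y = w *\<^sub>\<mu> (x *\<^sub>\<mu> y) = (w *\<^sub>\<mu> x) *\<^sub>\<mu>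
  y = x *\<^sub>\<mu> y = y\<close>.\<close>

lemma independentI:
  assumes "\<mu> < \<alpha>" "w \<in> carrier A" "x \<in> carrier A" "y \<in> carrier A"
    and "\<forall>w \<in> carrier A. sub A \<mu> w x = x" and "sub A \<mu> x y = y"
  shows "sub A \<mu> w y = y"
  using sub_assoc[of \<mu> w x y] assms by simp

lemma sub_independent_same:
  assumes "\<kappa> < \<alpha>" "w \<in> carrier A" "x \<in> carrier A" "y \<in> carrier A"
    and "\<forall>w \<in> carrier A. sub A \<kappa> w x = x"
  shows "sub A \<kappa> w (sub A \<kappa> x y) = sub A \<kappa> x y"
  using sub_assoc[of \<kappa> w x y] assms by simp

lemma sub_independent_other:
  assumes "\<kappa> < \<alpha>" "\<mu> < \<alpha>" "\<kappa> \<noteq> \<mu>" "w \<in> carrier A" "x \<in> carrier A" "y \<in> carrier A"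
    and "\<forall>w \<in> carrier A. sub A \<kappa> w x = x" and "\<forall>w \<in> carrier A. sub A \<mu> w x = x"
    and "\<forall>w \<in> carrier A. sub A \<mu> w y = y"
  shows "sub A \<mu> w (sub A \<kappa> x y) = sub A \<kappa> x y"
proof (rule independentI[of _ _ x])
  \<comment> \<open>Axiom (6) with \<open>x\<close> in two roles: \<open>x *\<^sub>\<kappa> (x
    *\<^sub>\<mu> y) = (x *\<^sub>\<kappa> x) *\<^sub>\<mu> (x *\<^sub>\<kappa> y)\<close>, where
    \<open>x *\<^sub>\<mu> y = y\<close> and \<open>x *\<^sub>\<kappa> x = x\<close>.\<close>
  show "sub A \<mu> x (sub A \<kappa> x y) = sub A \<kappa> x y"
    using sub_distrib[of \<kappa> \<mu> x x y] assms by simp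
qed (use assms sub_closed in auto)

lemma sub_commute:
  assumes "\<kappa> < \<alpha>" "\<mu> < \<alpha>" "\<kappa> \<noteq> \<mu>" "x \<in> carrier A" "y \<in> carrier A" "z \<in> carrier A"
    and "\<forall>w \<in> carrier A. sub A \<mu> w x = x" and "\<forall>w \<in> carrier A. sub A \<kappa> w y = y"
  shows "sub A \<kappa> x (sub A \<mu> y z) = sub A \<mu> y (sub A \<kappa> x z)"
  using sub_distrib[of \<kappa> \<mu> x y z] assms by simp

end

section \<open>Iterated substitution of elements of Z(\<Gamma>)\<close>

locale constant_assignment = substitution_algebra +
  fixes \<Gamma> s
  assumes index: "\<Gamma> \<subseteq> {..<\<alpha>}" and s: "\<And>\<kappa>. \<kappa> \<in> \<Gamma> \<Longrightarrow> s \<kappa> \<in> zero_dim \<alpha> A \<Gamma>"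
begin

lemma index_less: "\<kappa> \<in> \<Gamma> \<Longrightarrow> \<kappa> < \<alpha>"
  using index by auto

lemma s_carrier: "\<kappa> \<in> \<Gamma> \<Longrightarrow> s \<kappa> \<in> carrier A"
  using s by (simp add: zero_dim_def)

lemma s_independent:
  "\<lbrakk>\<kappa> \<in> \<Gamma>; \<mu> \<in> \<Gamma>; w \<in> carrier A\<rbrakk> \<Longrightarrow> sub A \<mu> w (s \<kappa>) = s \<kappa>"
  using s[of \<kappa>] by (simp add: zero_dim_iff[OF index])

lemma sub_s_carrier: "\<lbrakk>\<kappa> \<in> \<Gamma>; a \<in> carrier A\<rbrakk> \<Longrightarrow> sub A \<kappa> (s \<kappa>) a \<in> carrier A"
  by (simp add: index_less s_carrier sub_closed)

lemma list_sub_carrier: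
  "\<lbrakk>set xs \<subseteq> \<Gamma>; a \<in> carrier A\<rbrakk> \<Longrightarrow> list_sub A s xs a \<in> carrier A"
  by (induction xs arbitrary: a) (simp_all add: sub_s_carrier)

lemma list_sub_constant:
  "\<lbrakk>set xs \<subseteq> \<Gamma>; a \<in> carrier A; \<And>\<mu>. \<mu> \<in> set xs \<Longrightarrow> \<forall>w \<in> carrier A. sub A \<mu> w a = a\<rbrakk>
    \<Longrightarrow> list_sub A s xs a = a"
  by (induction xs) (simp_all add: s_carrier)

lemma list_sub_independent_preserved:
  assumes "set xs \<subseteq> \<Gamma>" "a \<in> carrier A" "\<mu> \<in> \<Gamma>" "\<forall>w \<in> carrier A. sub A \<mu> w a = a"
    and "w \<in> carrier A"
  shows "sub A \<mu> w (list_sub A s xs a) = list_sub A s xs a"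
  using assms
proof (induction xs arbitrary: a)
  case (Cons \<kappa> xs)
  have "sub A \<mu> w (sub A \<kappa> (s \<kappa>) a) = sub A \<kappa> (s \<kappa>) a" if "w \<in> carrier A" for w
    using Cons.prems that
    by (cases "\<mu> = \<kappa>")
      (auto intro: sub_independent_same sub_independent_other simp: index_less s_carrier s_independent)
  with Cons show ?case by (simp add: sub_s_carrier)
qed simp

text \<open>The substitution at \<open>\<mu>\<close> creates independence of \<open>\<mu>\<close>,
  by axiom (5), and the later substitutions preserve it.\<close>

lemma list_sub_independent:
  assumes "set xs \<subseteq> \<Gamma>" "a \<in> carrier A" "\<mu> \<in> set xs" "w \<in> carrier A"
  shows "sub A \<mu> w (list_sub A s xs a) = list_sub A s xs a"
proof -
  obtain ys zs where xs: "xs = ys @ \<mu> # zs" using assms(3) by (auto dest: split_list)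
  let ?b = "sub A \<mu> (s \<mu>) (list_sub A s ys a)"
  have "sub A \<mu> w ?b = ?b" if "w \<in> carrier A" for w
    using assms that
    by (intro sub_independent_same) (auto simp: xs index_less s_carrier s_independent list_sub_carrier)
  then show ?thesis
    using assms
    by (auto simp: xs sub_s_carrier list_sub_carrier intro!: list_sub_independent_preserved)
qed

text \<open>This makes Z(\<Gamma>) a legitimate base for the target algebra, and makes the value an
  admissible new entry of the assignment.\<close>

lemma list_sub_in_zero_dim:
  assumes "set xs = \<Gamma>" "a \<in> carrier A"
  shows "list_sub A s xs a \<in> zero_dim \<alpha> A \<Gamma>"
  using assms by (auto simp: zero_dim_iff[OF index] list_sub_carrier list_sub_independent)

lemma list_sub_commute:
  assumes "set xs \<subseteq> \<Gamma>" "\<kappa> \<in> \<Gamma>" "\<kappa> \<notin> set xs" "a \<in> carrier A"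
    and x: "x \<in> zero_dim \<alpha> A \<Gamma>"
  shows "list_sub A s xs (sub A \<kappa> x a) = sub A \<kappa> x (list_sub A s xs a)"
  using assms(1-4)
proof (induction xs arbitrary: a)
  case (Cons \<mu> xs)
  have x': "x \<in> carrier A" "\<And>\<mu> w. \<mu> \<in> \<Gamma> \<Longrightarrow> w \<in> carrier A \<Longrightarrow> sub A \<mu> w x = x"
    using x by (auto simp: zero_dim_iff[OF index])
  have "sub A \<mu> (s \<mu>) (sub A \<kappa> x a) = sub A \<kappa> x (sub A \<mu> (s \<mu>) a)"
    using Cons.prems x' by (intro sub_commute) (auto simp: index_less s_carrier s_independent)
  with Cons show ?case by (simp add: sub_s_carrier)
qed simp

text \<open>Axiom (6), once per index \<open>\<mu>\<close> in \<open>xs\<close>; its side condition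
  holds since \<open>s \<mu>\<close> is independent of \<open>\<kappa>\<close>.\<close>

lemma list_sub_distrib:
  assumes "set xs \<subseteq> \<Gamma>" "\<kappa> \<in> \<Gamma>" "\<kappa> \<notin> set xs" "a \<in> carrier A" "b \<in> carrier A"
  shows "list_sub A s xs (sub A \<kappa> a b) = sub A \<kappa> (list_sub A s xs a) (list_sub A s xs b)"
  using assms
proof (induction xs arbitrary: a b)
  case (Cons \<mu> xs)
  have "sub A \<mu> (s \<mu>) (sub A \<kappa> a b) = sub A \<kappa> (sub A \<mu> (s \<mu>) a) (sub A \<mu> (s \<mu>) b)"
    using Cons.prems by (intro sub_distrib) (auto simp: index_less s_carrier s_independent)
  with Cons show ?case by (simp add: sub_s_carrier)
qed simp

lemma list_sub_outermost:
  assumes "set (ys @ \<kappa> # zs) \<subseteq> \<Gamma>" "distinct (ys @ \<kappa> # zs)" "a \<in> carrier A"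
  shows "list_sub A s (ys @ \<kappa> # zs) a = sub A \<kappa> (s \<kappa>) (list_sub A s (ys @ zs) a)"
  using assms by (simp add: list_sub_commute s list_sub_carrier)

lemma list_sub_innermost:
  assumes "set (ys @ \<kappa> # zs) \<subseteq> \<Gamma>" "distinct (ys @ \<kappa> # zs)" "a \<in> carrier A"
  shows "list_sub A s (ys @ \<kappa> # zs) a = list_sub A s (ys @ zs) (sub A \<kappa> (s \<kappa>) a)"
  using assms by (simp add: list_sub_commute s)

text \<open>With \<open>\<kappa>\<close> moved innermost, the variable becomes
  \<open>s \<kappa>\<close>, which all remaining substitutions fix.\<close>

lemma list_sub_var:
  assumes "set xs = \<Gamma>" "distinct xs" "\<kappa> \<in> \<Gamma>"
  shows "list_sub A s xs (var A \<kappa>) = s \<kappa>"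
proof -
  obtain ys zs where xs: "xs = ys @ \<kappa> # zs" using assms by (auto dest: split_list)
  have "list_sub A s xs (var A \<kappa>) = list_sub A s (ys @ zs) (sub A \<kappa> (s \<kappa>) (var A \<kappa>))"
    unfolding xs using assms by (intro list_sub_innermost) (auto simp: xs var_closed index_less)
  also have "\<dots> = list_sub A s (ys @ zs) (s \<kappa>)"
    using assms by (simp add: sub_var index_less s_carrier)
  also have "\<dots> = s \<kappa>"
    using assms by (intro list_sub_constant) (auto simp: xs s_carrier s_independent)
  finally show ?thesis .
qed

lemma list_sub_sub:
  assumes "set xs = \<Gamma>" "distinct xs" "\<kappa> \<in> \<Gamma>" "a \<in> carrier A" "b \<in> carrier A"
  shows "list_sub A s xs (sub A \<kappa> a b) = list_sub A (s(\<kappa> := list_sub A s xs a)) xs b"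
proof -
  obtain ys zs where xs: "xs = ys @ \<kappa> # zs" using assms by (auto dest: split_list)
  let ?c = "list_sub A s xs a" and ?xs' = "ys @ zs"
  \<comment> \<open>The new entry \<open>?c\<close> lies in Z(\<Gamma>), so every fact about
    \<open>s\<close> is also available for the updated assignment.\<close>
  interpret updated: constant_assignment \<alpha> A \<Gamma> "s(\<kappa> := ?c)"
    by unfold_locales (use assms in \<open>auto simp: index_less s list_sub_in_zero_dim\<close>)
  have sub_xs': "set ?xs' \<subseteq> \<Gamma>" "\<kappa> \<notin> set ?xs'" using assms xs by auto
  have "list_sub A s xs (sub A \<kappa> a b) = list_sub A s ?xs' (sub A \<kappa> (s \<kappa>) (sub A \<kappa> a b))"
    unfolding xs using assms by (intro list_sub_innermost) (auto simp: xs sub_closed index_less)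
  also have "\<dots> = list_sub A s ?xs' (sub A \<kappa> (sub A \<kappa> (s \<kappa>) a) b)"
    using assms by (simp add: sub_assoc index_less s_carrier)
  also have "\<dots> = sub A \<kappa> (list_sub A s ?xs' (sub A \<kappa> (s \<kappa>) a)) (list_sub A s ?xs' b)"
    using assms sub_xs' by (intro list_sub_distrib) (auto simp: sub_s_carrier)
  also have "list_sub A s ?xs' (sub A \<kappa> (s \<kappa>) a) = ?c"
    unfolding xs using assms by (intro list_sub_innermost[symmetric]) (auto simp: xs)
  \<comment> \<open>The update at \<open>\<kappa>\<close> is invisible to \<open>?xs'\<close>, which
    omits \<open>\<kappa>\<close>.\<close>
  also have "list_sub A s ?xs' b = list_sub A (s(\<kappa> := ?c)) ?xs' b"
    using sub_xs' by (intro list_sub_cong) auto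
  \<comment> \<open>This is the form with \<open>\<kappa>\<close> outermost for the updated
    assignment, whose entry at \<open>\<kappa>\<close> is \<open>?c\<close>.\<close>
  also have "sub A \<kappa> ?c \<dots> = list_sub A (s(\<kappa> := ?c)) xs b"
    using updated.list_sub_outermost[of ys \<kappa> zs b] assms unfolding xs[symmetric] by simp
  finally show ?thesis .
qed

end

theorem theorem2p5:
  fixes \<alpha> :: "'o::wellorder"
    and A :: "('o, 'a) subst_struct"
    and \<Gamma> :: "'o set"
  assumes "substitution_algebra \<alpha> A"
    and "finite \<Gamma>"
    and "\<Gamma> \<subseteq> {..<\<alpha>}"
  shows "partial_hom \<alpha> \<Gamma> A (full_function_algebra \<alpha> (zero_dim \<alpha> A \<Gamma>)) (phi_map \<alpha> A \<Gamma>)"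
proof -
  interpret substitution_algebra \<alpha> A by fact
  let ?Z = "zero_dim \<alpha> A \<Gamma>" and ?\<phi> = "phi_map \<alpha> A \<Gamma>"
  let ?F = "full_function_algebra \<alpha> ?Z" and ?xs = "sorted_list_of_set \<Gamma>"
  have xs: "set ?xs = \<Gamma>" "distinct ?xs" using \<open>finite \<Gamma>\<close> by simp_all
  have less: "\<kappa> < \<alpha>" if "\<kappa> \<in> \<Gamma>" for \<kappa> using assms(3) that by auto
  have assignment: "constant_assignment \<alpha> A \<Gamma> s" if "s \<in> seqs \<alpha> ?Z" for s
    by unfold_locales (use assms(3) less that in \<open>auto simp: seqs_mem\<close>)
  have phi: "?\<phi> a s = list_sub A s ?xs a" if "s \<in> seqs \<alpha> ?Z" for a s
    using that by (simp add: phi_map_def gen_sub_def list_sub_def)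
  have phi_mem: "?\<phi> a s \<in> ?Z" if "a \<in> carrier A" "s \<in> seqs \<alpha> ?Z" for a s
    using constant_assignment.list_sub_in_zero_dim[OF assignment xs(1)] that by (simp add: phi)
  \<comment> \<open>Off the sequences over Z(\<Gamma>), both sides of the homomorphism equations
    take this default value, so they can be proved as equations of total functions.\<close>
  have phi_undefined: "?\<phi> a s = undefined" if "s \<notin> seqs \<alpha> ?Z" for a s
    using that by (simp add: phi_map_def)
  have closed: "?\<phi> \<in> carrier A \<rightarrow> carrier ?F"
    using phi_mem phi_undefined by (auto simp: carrier_full_function_algebra)
  have sub: "?\<phi> (sub A \<kappa> a b) = sub ?F \<kappa> (?\<phi> a) (?\<phi> b)"
    if "\<kappa> \<in> \<Gamma>" "a \<in> carrier A" "b \<in> carrier A" for \<kappa> a b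
  proof
    fix s
    show "?\<phi> (sub A \<kappa> a b) s = sub ?F \<kappa> (?\<phi> a) (?\<phi> b) s"
    proof (cases "s \<in> seqs \<alpha> ?Z")
      case True
      \<comment> \<open>The right-hand side evaluates \<open>?\<phi> b\<close> at this sequence, and
        \<open>phi\<close> unfolds it only for members of \<open>seqs \<alpha> ?Z\<close>.\<close>
      have "s(\<kappa> := ?\<phi> a s) \<in> seqs \<alpha> ?Z"
        using True that by (intro seqs_update less phi_mem)
      then show ?thesis
        using constant_assignment.list_sub_sub[OF assignment[OF True] xs that] True
        by (simp add: sub_full_function_algebra phi)
    next
      case False
      then show ?thesis by (simp add: phi_undefined full_function_algebra_def)
    qed
  qed
  have var: "?\<phi> (var A \<kappa>) = var ?F \<kappa>" if "\<kappa> \<in> \<Gamma>" for \<kappa>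
  proof
    fix s
    show "?\<phi> (var A \<kappa>) s = var ?F \<kappa> s"
      using constant_assignment.list_sub_var[OF assignment xs that]
      by (cases "s \<in> seqs \<alpha> ?Z")
        (simp_all add: phi phi_undefined full_function_algebra_def)
  qed
  show ?thesis
    unfolding partial_hom_def
    using assms closed sub var substitution_algebra_full_function_algebra by blast
qed

end
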